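(* Let $q$ be a prime power. In ${\rm PG}(7,q)$ let $U_i$ be the point with $1$ in position $i$ and $0$ elsewhere, let $\Sigma=\langle U_5,U_6,U_7,U_8\rangle$ and $\Sigma'=\langle U_1,U_2,U_3,U_4\rangle$. Let $\mathcal A$ be a $(4\times 4,3)_q$ MRD--code and $\mathcal X=\{L(A)\mid A\in\mathcal A\}$ (a set of $q^8$ solids). Let $\mathcal S$ be a line--spread of $\Sigma$, $\mathcal S'$ a line--spread of $\Sigma'$, and $\mu:\mathcal S'\to\mathcal S$ a bijection. For $\ell'\in\mathcal S'$ let $\Gamma_{\ell'}=\langle\Sigma,\ell'\rangle$ (a $5$--dimensional subspace) and let $\mathcal Y_{\ell'}$ be the set of the $q(q+1)^2$ solids of $\Gamma_{\ell'}$ that meet $\Sigma$ exactly in a plane containing the line $\mu(\ell')$. Let $\mathcal Y=\bigcup_{\ell'\in\mathcal S'}\mathcal Y_{\ell'}$. Then $\mathcal X\cup\mathcal Y$ is a $q$--covering design $\mathbb{C}_q(8,4,2)$ (every line of ${\rm PG}(7,q)$ is contained in at least one of its solids) of size $q^8+q(q+1)^2(q^2+1)$.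
   Context: A solid is a 3--dimensional projective subspace. A $(4\times4,3)_q$ MRD--code is a set of $q^8$ matrices in $\mathcal M_{4\times4}({\rm GF}(q))$ with $\mathrm{rank}(A-B)\ge3$ for all distinct $A,B$ in it. For a $4\times4$ matrix $A$, $L(A)$ is the solid of ${\rm PG}(7,q)$ spanned by the points whose coordinate vectors are the rows of $(I_4\,|\,A)$. A line--spread of ${\rm PG}(3,q)$ is a set of $q^2+1$ lines partitioning its points. A $q$--covering design $\mathbb{C}_q(n,k,r)$ is a collection of $(k-1)$--dimensional subspaces of ${\rm PG}(n-1,q)$ such that every $(r-1)$--dimensional subspace is contained in at least one of them. *)

theory Defs
  imports "HOL-Analysis.Analysis"
begin

text \<open>
  PG(n-1,q) is the lattice of vector subspaces of \<open>'a^'n\<close>, where \<open>'a\<close> is a finite field of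
  order q and \<open>n = CARD('n)\<close>.  For a numeral index type such as \<open>8\<close> the positions are
  \<open>1, \<dots>, 8\<close>, with \<open>8 = 0\<close> (the convention of the library function \<open>vector\<close>).
\<close>

definition proj_dim :: "('a::field^'n) set \<Rightarrow> int"
  where "proj_dim W = int (vec.dim W) - 1"

definition proj_subspaces :: "int \<Rightarrow> ('a::field^'n) set set"
  where "proj_subspaces d = {W. vec.subspace W \<and> proj_dim W = d}"

abbreviation "pg_points \<equiv> proj_subspaces 0"
abbreviation "pg_lines \<equiv> proj_subspaces 1"
abbreviation "pg_planes \<equiv> proj_subspaces 2"
abbreviation "pg_solids \<equiv> proj_subspaces 3"

definition pg_join :: "('a::field^'n) set \<Rightarrow> ('a^'n) set \<Rightarrow> ('a^'n) set"
  where "pg_join V W = vec.span (V \<union> W)"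

definition q_covering_design :: "nat \<Rightarrow> nat \<Rightarrow> ('a::field^'n) set set \<Rightarrow> bool"
  where "q_covering_design k r C \<longleftrightarrow>
    C \<subseteq> proj_subspaces (int k - 1) \<and>
    (\<forall>R \<in> proj_subspaces (int r - 1). \<exists>W \<in> C. R \<subseteq> W)"

definition line_spread :: "('a::{field,finite}^'n) set \<Rightarrow> ('a^'n) set set \<Rightarrow> bool"
  where "line_spread T S \<longleftrightarrow>
    S \<subseteq> {l \<in> pg_lines. l \<subseteq> T} \<and> card S = CARD('a)^2 + 1 \<and>
    (\<forall>P \<in> pg_points. P \<subseteq> T \<longrightarrow> (\<exists>!l. l \<in> S \<and> P \<subseteq> l))"

definition mrd_code_4_3 :: "('a::{field,finite}^4^4) set \<Rightarrow> bool"
  where "mrd_code_4_3 \<A> \<longleftrightarrow>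
    card \<A> = CARD('a)^8 \<and> (\<forall>A\<in>\<A>. \<forall>B\<in>\<A>. A \<noteq> B \<longrightarrow> rank (A - B) \<ge> 3)"

text \<open>The \<open>4 \<times> 8\<close> block matrix \<open>(I | A)\<close>.\<close>
definition id_block :: "'a::field^4^4 \<Rightarrow> 'a^8^4"
  where "id_block A =
    (\<chi> i. vector (map (\<lambda>j. (mat 1 :: 'a^4^4) $ i $ j) [1, 2, 3, 4] @ map (\<lambda>j. A $ i $ j) [1, 2, 3, 4]))"

definition lifted_solid :: "'a::field^4^4 \<Rightarrow> ('a^8) set"
  where "lifted_solid A = vec.span (rows (id_block A))"

definition solid_Sigma :: "('a::field^8) set"
  where "solid_Sigma = vec.span {axis 5 1, axis 6 1, axis 7 1, axis 8 1}"

definition solid_Sigma' :: "('a::field^8) set"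
  where "solid_Sigma' = vec.span {axis 1 1, axis 2 1, axis 3 1, axis 4 1}"

definition Gamma_sub :: "('a::field^8) set \<Rightarrow> ('a^8) set"
  where "Gamma_sub l' = pg_join solid_Sigma l'"

definition Y_solids :: "(('a::field^8) set \<Rightarrow> ('a^8) set) \<Rightarrow> ('a^8) set \<Rightarrow> ('a^8) set set"
  where "Y_solids \<mu> l' =
    {W \<in> pg_solids. W \<subseteq> Gamma_sub l' \<and> W \<inter> solid_Sigma \<in> pg_planes \<and> \<mu> l' \<subseteq> W \<inter> solid_Sigma}"

end

theory Submission
  imports Defs
begin

text \<open>
  Let R be a line.  If R misses \<open>\<Sigma>\<close>, it projects to a line of \<open>\<Sigma>'\<close> spanned by two vectors
  \<open>u1, u2\<close>, and R lies in \<open>L(A)\<close> as soon as \<open>u1 A, u2 A\<close> have prescribed values; the minimum rank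
  distance and the size of the code force exactly one codeword to do so.  If R contains a point P
  of \<open>\<Sigma>\<close>, choose \<open>l'\<close> as the spread line through the projection to \<open>\<Sigma>'\<close> of a point of R
  outside \<open>\<Sigma>\<close> and extend \<open>\<mu>(l')\<close> to a plane of \<open>\<Sigma>\<close> containing P; when R lies in \<open>\<Sigma>\<close>, choose
  \<open>l'\<close> with P on \<open>\<mu>(l')\<close> and extend \<open>\<mu>(l')\<close> to a plane containing R.  The solids are counted
  by partitioning \<open>V - T\<close> into the sets \<open>W - B\<close>, for the W between B and V of dimension
  \<open>dim B + 1\<close> that meet T exactly in B.
\<close>

section \<open>Subspaces over a finite field\<close>

lemma card_field_ge_2: "2 \<le> CARD('a::{field,finite})"
proof -
  have "card {0, 1::'a} \<le> CARD('a)"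
    by (rule card_mono) auto
  then show ?thesis by simp
qed

text \<open>Induction over a basis: every vector of \<open>vec.span (insert b B)\<close> is
  \<open>x + k *s b\<close> for exactly one pair \<open>(k, x)\<close>, so each basis vector
  multiplies the size by the order of the field.\<close>

lemma card_subspace:
  fixes V :: "('a::{field,finite}^'n) set"
  assumes "vec.subspace V"
  shows "card V = CARD('a) ^ vec.dim V"
proof -
  obtain B where B: "B \<subseteq> V" "vec.independent B" "vec.span B = V" "card B = vec.dim V" "finite B"
    using vec.basis_subspace_exists[OF assms] by metis
  have "card (vec.span B) = CARD('a) ^ card B"
    using \<open>finite B\<close> \<open>vec.independent B\<close>
  proof (induction B rule: finite_induct)
    case empty
    then show ?case by simp
  next
    case (insert b B)
    have b: "b \<notin> vec.span B" and iB: "vec.independent B"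
      using insert.prems insert.hyps(2) by (simp_all add: vec.independent_insert)
    have "bij_betw (\<lambda>(k, x). x + k *s b) (UNIV \<times> vec.span B) (vec.span (insert b B))"
    proof (rule bij_betw_imageI)
      show "inj_on (\<lambda>(k, x). x + k *s b) (UNIV \<times> vec.span B)"
      proof (rule inj_onI, clarify)
        fix k x l y
        assume xy: "x \<in> vec.span B" "y \<in> vec.span B" and eq: "x + k *s b = y + l *s b"
        have "(k - l) *s b = y - x"
          using eq by (simp add: algebra_simps vec.scale_left_diff_distrib)
        then have mem: "(k - l) *s b \<in> vec.span B"
          using xy by (simp add: vec.span_diff)
        have "k = l"
        proof (rule ccontr)
          assume "k \<noteq> l"
          then have "inverse (k - l) *s ((k - l) *s b) = b"
            by (subst vec.scale_scale) simp
          then show False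
            using vec.span_scale[OF mem, of "inverse (k - l)"] b by simp
        qed
        then show "k = l \<and> x = y"
          using eq by simp
      qed
      show "(\<lambda>(k, x). x + k *s b) ` (UNIV \<times> vec.span B) = vec.span (insert b B)"
      proof (intro set_eqI iffI)
        fix z
        assume "z \<in> (\<lambda>(k, x). x + k *s b) ` (UNIV \<times> vec.span B)"
        then obtain k x where "x \<in> vec.span B" "z = x + k *s b"
          by auto
        then show "z \<in> vec.span (insert b B)"
          by (auto simp: vec.span_breakdown_eq intro: exI[of _ k])
      next
        fix z
        assume "z \<in> vec.span (insert b B)"
        then obtain k where "z - k *s b \<in> vec.span B"
          by (auto simp: vec.span_breakdown_eq)
        then show "z \<in> (\<lambda>(k, x). x + k *s b) ` (UNIV \<times> vec.span B)"
          by (intro image_eqI[of _ _ "(k, z - k *s b)"]) auto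
      qed
    qed
    then have "card (vec.span (insert b B)) = CARD('a) * card (vec.span B)"
      using bij_betw_same_card by (fastforce simp: card_cartesian_product)
    then show ?case
      using insert.IH[OF iB] insert.hyps by simp
  qed
  with B show ?thesis by simp
qed

text \<open>Dimensions can be found by counting, because powers of a base greater than 1 determine
  the exponent.\<close>

lemma dim_eqI_card:
  fixes V :: "('a::{field,finite}^'n) set"
  assumes "vec.subspace V" "card V = CARD('a) ^ d"
  shows "vec.dim V = d"
proof -
  have "CARD('a) ^ vec.dim V = CARD('a) ^ d"
    using card_subspace[OF assms(1)] assms(2) by simp
  moreover have "1 < CARD('a)"
    using card_field_ge_2[where 'a='a] by simp
  ultimately show ?thesis
    using power_inject_exp by blast
qed

text \<open>Addition maps \<open>V \<times> W\<close> bijectively onto the span: two pairs with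
  equal sums differ by vectors of the trivial intersection. Comparing sizes gives the
  dimension.\<close>

lemma dim_span_Un_disjoint:
  fixes V W :: "('a::{field,finite}^'n) set"
  assumes V: "vec.subspace V" and W: "vec.subspace W" and VW: "V \<inter> W \<subseteq> {0}"
  shows "vec.dim (vec.span (V \<union> W)) = vec.dim V + vec.dim W"
proof (rule dim_eqI_card)
  have "inj_on (\<lambda>(x, y). x + y) (V \<times> W)"
  proof (rule inj_onI, clarify)
    fix a b c d
    assume m: "a \<in> V" "b \<in> W" "c \<in> V" "d \<in> W" and eq: "a + b = c + d"
    then have "a - c = d - b" by (simp add: algebra_simps)
    moreover have "a - c \<in> V" "d - b \<in> W"
      using m V W by (simp_all add: vec.subspace_diff)
    ultimately have "a - c = 0" using VW by auto
    then show "a = c \<and> b = d" using eq by simp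
  qed
  moreover have "vec.span (V \<union> W) = (\<lambda>(x, y). x + y) ` (V \<times> W)"
    using V W by (auto simp: vec.span_Un vec.span_eq_iff[THEN iffD2])
  ultimately show "card (vec.span (V \<union> W)) = CARD('a) ^ (vec.dim V + vec.dim W)"
    by (simp add: card_image card_cartesian_product card_subspace V W power_add)
qed simp

section \<open>Extensions of a subspace by one dimension\<close>

lemma dim_span_insert_subspace:
  fixes B :: "('a::field^'n) set"
  assumes "vec.subspace B" "x \<notin> B"
  shows "vec.dim (vec.span (insert x B)) = vec.dim B + 1"
proof -
  have "x \<notin> vec.span B"
    using assms vec.span_eq_iff by blast
  then show ?thesis
    by (simp add: vec.dim_insert)
qed

lemma extension_eq_span_insert:
  fixes B W :: "('a::field^'n) set"
  assumes "vec.subspace B" "vec.subspace W" "B \<subseteq> W" "vec.dim W = vec.dim B + 1" "x \<in> W" "x \<notin> B"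
  shows "vec.span (insert x B) = W"
proof (rule vec.subspace_dim_equal)
  show "vec.span (insert x B) \<subseteq> W"
    using assms by (intro vec.span_minimal) auto
  show "vec.dim W \<le> vec.dim (vec.span (insert x B))"
    using assms dim_span_insert_subspace[of B x] by simp
qed (use assms in auto)

text \<open>If \<open>y + k *s v\<close> lies in \<open>T\<close> with \<open>y\<close> in
  \<open>B\<close>, then so does \<open>k *s v\<close>, which forces \<open>k = 0\<close> as
  \<open>v\<close> is outside \<open>T\<close>.\<close>

lemma span_insert_Int_subspace:
  fixes B T :: "('a::field^'n) set"
  assumes B: "vec.subspace B" and T: "vec.subspace T" and BT: "B \<subseteq> T" and v: "v \<notin> T"
  shows "vec.span (insert v B) \<inter> T = B"
proof
  show "B \<subseteq> vec.span (insert v B) \<inter> T"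
    using BT by (auto intro: vec.span_base)
  show "vec.span (insert v B) \<inter> T \<subseteq> B"
  proof
    fix x assume x: "x \<in> vec.span (insert v B) \<inter> T"
    then obtain k where "x - k *s v \<in> vec.span B"
      by (auto simp: vec.span_breakdown_eq)
    then have k: "x - k *s v \<in> B"
      using B vec.span_eq_iff by blast
    have "x - (x - k *s v) \<in> T"
      by (rule vec.subspace_diff[OF T]) (use x k BT in blast)+
    moreover have "x - (x - k *s v) = k *s v" by (rule diff_diff_eq2[THEN trans]) simp
    ultimately have kv: "k *s v \<in> T" by (simp only:)
    have "k = 0"
    proof (rule ccontr)
      assume "k \<noteq> 0"
      then have "inverse k *s (k *s v) = v" by simp
      then show False
        using vec.subspace_scale[OF T kv, of "inverse k"] v by simp
    qed
    then show "x \<in> B" using k by simp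
  qed
qed

text \<open>A vector \<open>x\<close> of \<open>V - T\<close> lies in exactly one member of
  \<open>F\<close>, namely \<open>vec.span (insert x B)\<close>, and all the sets
  \<open>W - B\<close> have the same size, the second factor on the left. For \<open>T = B\<close>
  the condition \<open>W \<inter> T = B\<close> is just \<open>B \<subseteq> W\<close>, so that case
  counts all extensions of \<open>B\<close> in \<open>V\<close>.\<close>

lemma card_extensions:
  fixes B T V :: "('a::{field,finite}^'n) set"
  assumes B: "vec.subspace B" and T: "vec.subspace T" and V: "vec.subspace V"
    and BT: "B \<subseteq> T" and TV: "T \<subseteq> V"
  defines "F \<equiv> {W. vec.subspace W \<and> W \<subseteq> V \<and> vec.dim W = vec.dim B + 1 \<and> W \<inter> T = B}"
  shows "card F * (CARD('a) ^ (vec.dim B + 1) - CARD('a) ^ vec.dim B)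
    = CARD('a) ^ vec.dim V - CARD('a) ^ vec.dim T"
proof -
  have BW: "B \<subseteq> W" if "W \<in> F" for W
    using that by (auto simp: F_def)
  have ext: "vec.span (insert x B) = W" if "W \<in> F" "x \<in> W" "x \<notin> B" for W x
    using that BW[OF that(1)] by (intro extension_eq_span_insert[OF B]) (auto simp: F_def)
  have union: "(\<Union>W\<in>F. W - B) = V - T"
  proof (intro set_eqI iffI)
    fix x assume "x \<in> (\<Union>W\<in>F. W - B)"
    then show "x \<in> V - T" by (auto simp: F_def)
  next
    fix x assume x: "x \<in> V - T"
    then have "x \<notin> B" using BT by auto
    moreover have "vec.span (insert x B) \<in> F"
      unfolding F_def
      using x BT TV dim_span_insert_subspace[OF B \<open>x \<notin> B\<close>] span_insert_Int_subspace[OF B T BT, of x]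
        vec.span_minimal[OF _ V, of "insert x B"] by auto
    ultimately show "x \<in> (\<Union>W\<in>F. W - B)"
      by (auto intro!: bexI[of _ "vec.span (insert x B)"] vec.span_base)
  qed
  have card: "card (W - B) = CARD('a) ^ (vec.dim B + 1) - CARD('a) ^ vec.dim B" if "W \<in> F" for W
  proof -
    have "card (W - B) = card W - card B"
      using BW[OF that] by (simp add: card_Diff_subset)
    then show ?thesis
      using that B card_subspace[of W] card_subspace[of B] by (simp add: F_def)
  qed
  have "card (\<Union>W\<in>F. W - B) = (\<Sum>W\<in>F. card (W - B))"
  proof (rule card_UN_disjoint)
    show "\<forall>W1\<in>F. \<forall>W2\<in>F. W1 \<noteq> W2 \<longrightarrow> (W1 - B) \<inter> (W2 - B) = {}"
      using ext by blast
  qed auto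
  also have "\<dots> = card F * (CARD('a) ^ (vec.dim B + 1) - CARD('a) ^ vec.dim B)"
    using card by simp
  finally show ?thesis
    using TV by (simp only: union) (simp add: card_Diff_subset card_subspace V T)
qed

text \<open>Adjoin \<open>p\<close> itself, unless it is already in \<open>l\<close>; then
  strictness of \<open>l \<subset> T\<close> supplies another vector to adjoin.\<close>

lemma exists_extension_containing:
  fixes l T :: "('a::field^'n) set"
  assumes l: "vec.subspace l" and T: "vec.subspace T" and lT: "l \<subset> T" and p: "p \<in> T"
  obtains E where "vec.subspace E" "E \<subseteq> T" "l \<subseteq> E" "p \<in> E" "vec.dim E = vec.dim l + 1"
proof -
  obtain v where v: "v \<in> T" "v \<notin> l" "p \<in> vec.span (insert v l)"
  proof (cases "p \<in> l")
    case True
    obtain v where "v \<in> T" "v \<notin> l" using lT by auto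
    with True that show ?thesis by (meson insertCI vec.span_base)
  next
    case False
    with p that show ?thesis by (meson insertCI vec.span_base)
  qed
  show ?thesis
  proof (rule that[of "vec.span (insert v l)"])
    show "vec.span (insert v l) \<subseteq> T"
      using v lT by (intro vec.span_minimal[OF _ T]) auto
    show "vec.dim (vec.span (insert v l)) = vec.dim l + 1"
      using dim_span_insert_subspace[OF l v(2)] .
  qed (use v in \<open>auto intro: vec.span_base\<close>)
qed

text \<open>Allows one generator of a line to be prescribed, such as a point of the line on
  \<Sigma>.\<close>

lemma dim_2_eq_span_pair:
  fixes R :: "('a::field^'n) set"
  assumes R: "vec.subspace R" "vec.dim R = 2" and r: "r \<in> R" "r \<noteq> 0"
  obtains w where "w \<in> R" "w \<notin> vec.span {r}" "R = vec.span {w, r}"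
proof -
  have d: "vec.dim (vec.span {r}) = 1"
    using r by (simp del: vec.dim_span add: vec.dim_span)
  have sub: "vec.span {r} \<subseteq> R"
    using r R by (simp add: vec.span_minimal)
  have "\<not> R \<subseteq> vec.span {r}"
    using vec.dim_subset[of R "vec.span {r}"] d R by auto
  then obtain w where w: "w \<in> R" "w \<notin> vec.span {r}" by auto
  have "vec.span (insert w (vec.span {r})) = R"
    using w d R sub by (intro extension_eq_span_insert) auto
  moreover have "vec.span (insert w (vec.span {r})) = vec.span {w, r}"
    by (simp only: vec.span_insert[of w "vec.span {r}"] vec.span_insert[of w "{r}"] vec.span_span)
  ultimately show ?thesis
    using w that by blast
qed

section \<open>Row actions of matrices\<close>

lemma linear_vector_matrix_mult: "Vector_Spaces.linear (*s) (*s) (\<lambda>v. v v* M)"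
  for M :: "'a::field^'n^'m"
  by unfold_locales (vector vector_matrix_mult_def sum.distrib sum_distrib_left algebra_simps)+

lemma axis_vector_matrix_mult: "axis i 1 v* M = row i M"
  for M :: "'a::semiring_1^'n^'m"
proof -
  have "(\<Sum>k\<in>UNIV. (if k = i then 1 else 0) * M $ k $ j) = (\<Sum>k\<in>UNIV. if k = i then M $ k $ j else 0)" for j
    by (rule sum.cong) auto
  then show ?thesis
    by (simp add: vector_matrix_mult_def row_def axis_def vec_eq_iff)
qed

text \<open>The rows are the images of the unit vectors, and a linear map carries spans to
  spans.\<close>

lemma span_rows: "vec.span (rows M) = range (\<lambda>v. v v* M)"
  for M :: "'a::field^'n^'m"
proof -
  have "rows M = (\<lambda>v. v v* M) ` cart_basis"
    by (force simp: rows_def cart_basis_def axis_vector_matrix_mult)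
  then have "vec.span (rows M) = (\<lambda>v. v v* M) ` vec.span cart_basis"
    by (simp only: vec.linear_span_image[OF linear_vector_matrix_mult])
  then show ?thesis
    by (simp only: span_cart_basis)
qed

text \<open>Extend the two vectors to a basis of the whole space. The images of the basis span the
  row space, and two of them vanish.\<close>

lemma rank_le_of_left_kernel:
  fixes M :: "'a::field^'n^'m"
  assumes u: "u1 \<noteq> 0" "u2 \<notin> vec.span {u1}" and z: "u1 v* M = 0" "u2 v* M = 0"
  shows "rank M + 2 \<le> CARD('m)"
proof -
  have ind: "vec.independent {u2, u1}"
    using u by (intro vec.independent_insertI) (simp_all add: vec.independent_empty)
  define B where "B = vec.extend_basis {u2, u1}"
  have B: "{u2, u1} \<subseteq> B" "vec.independent B" "vec.span B = UNIV"
    unfolding B_def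
    by (fact vec.extend_basis_superset[OF ind] vec.independent_extend_basis[OF ind] vec.span_extend_basis[OF ind])+
  have fin: "finite B" and cB: "card B = CARD('m)"
    using B vec.finiteI_independent vec.dim_span_eq_card_independent[OF B(2)]
    by (auto simp: B(3) vec_dim_card simp del: vec.dim_UNIV)
  have ne: "u1 \<noteq> u2" using u by (auto intro: vec.span_base)
  let ?f = "\<lambda>v. v v* M"
  have "vec.span (rows M) = ?f ` vec.span B"
    by (simp add: span_rows B)
  also have "\<dots> = vec.span (?f ` B)"
    by (rule vec.linear_span_image[OF linear_vector_matrix_mult, symmetric])
  finally have "rank M = vec.dim (vec.span (?f ` B))"
    by (metis row_rank_def_gen vec.dim_span)
  also have "\<dots> \<le> card (?f ` (B - {u1, u2}))"
  proof (rule vec.dim_le_card)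
    have "?f ` B \<subseteq> insert 0 (?f ` (B - {u1, u2}))"
      using z by auto
    then show "vec.span (?f ` B) \<subseteq> vec.span (?f ` (B - {u1, u2}))"
      by (metis vec.span_insert_0 vec.span_mono)
  qed (use fin in simp)
  also have "\<dots> \<le> card (B - {u1, u2})"
    by (rule card_image_le) (use fin in simp)
  finally have le: "rank M \<le> card (B - {u1, u2})" .
  \<comment> \<open>This bound keeps the subtraction of naturals in the next step from
    truncating.\<close>
  have "card {u1, u2} \<le> card B"
    by (rule card_mono[OF fin]) (use B(1) in auto)
  moreover have "card (B - {u1, u2}) = card B - card {u1, u2}"
    by (rule card_Diff_subset) (use B(1) in auto)
  ultimately show ?thesis
    using le ne cB by simp
qed
section \<open>Coordinates\<close>

lemma exhaust_8:
  fixes x :: 8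
  shows "x = 1 \<or> x = 2 \<or> x = 3 \<or> x = 4 \<or> x = 5 \<or> x = 6 \<or> x = 7 \<or> x = 8"
proof (induct x)
  case (of_int z)
  \<comment> \<open>The representatives run from 0 to 7; the index 8 is the one represented by
    0.\<close>
  then have "z = 0 \<or> z = 1 \<or> z = 2 \<or> z = 3 \<or> z = 4 \<or> z = 5 \<or> z = 6 \<or> z = 7" by fastforce
  then show ?case by auto
qed

lemma forall_8: "(\<forall>i::8. P i) \<longleftrightarrow> P 1 \<and> P 2 \<and> P 3 \<and> P 4 \<and> P 5 \<and> P 6 \<and> P 7 \<and> P 8"
  by (metis exhaust_8)

lemma vector_4:
  "(vector [a, b, c, d] :: 'a::zero^4) $ 1 = a"
  "(vector [a, b, c, d] :: 'a::zero^4) $ 2 = b"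
  "(vector [a, b, c, d] :: 'a::zero^4) $ 3 = c"
  "(vector [a, b, c, d] :: 'a::zero^4) $ 4 = d"
  unfolding vector_def by simp_all

lemma vector_8:
  "(vector [a, b, c, d, e, f, g, h] :: 'a::zero^8) $ 1 = a"
  "(vector [a, b, c, d, e, f, g, h] :: 'a::zero^8) $ 2 = b"
  "(vector [a, b, c, d, e, f, g, h] :: 'a::zero^8) $ 3 = c"
  "(vector [a, b, c, d, e, f, g, h] :: 'a::zero^8) $ 4 = d"
  "(vector [a, b, c, d, e, f, g, h] :: 'a::zero^8) $ 5 = e"
  "(vector [a, b, c, d, e, f, g, h] :: 'a::zero^8) $ 6 = f"
  "(vector [a, b, c, d, e, f, g, h] :: 'a::zero^8) $ 7 = g"
  "(vector [a, b, c, d, e, f, g, h] :: 'a::zero^8) $ 8 = h"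
  unfolding vector_def by simp_all

text \<open>In these coordinates \<open>head4\<close> is the projection from \<Sigma> onto
  \<Sigma>', \<open>tail4\<close> the complementary projection onto \<Sigma>, and
  \<open>glue\<close> reassembles the two halves.\<close>

definition head4 :: "'a::zero^8 \<Rightarrow> 'a^4"
  where "head4 x = vector [x $ 1, x $ 2, x $ 3, x $ 4]"

definition tail4 :: "'a::zero^8 \<Rightarrow> 'a^4"
  where "tail4 x = vector [x $ 5, x $ 6, x $ 7, x $ 8]"

definition glue :: "'a::zero^4 \<Rightarrow> 'a^4 \<Rightarrow> 'a^8"
  where "glue c d = vector [c $ 1, c $ 2, c $ 3, c $ 4, d $ 1, d $ 2, d $ 3, d $ 4]"

lemma head4_glue [simp]: "head4 (glue c d) = c"
  by (simp add: head4_def glue_def vec_eq_iff forall_4 vector_4 vector_8)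

lemma tail4_glue [simp]: "tail4 (glue c d) = d"
  by (simp add: tail4_def glue_def vec_eq_iff forall_4 vector_4 vector_8)

lemma glue_head4_tail4 [simp]: "glue (head4 x) (tail4 x) = x"
  by (simp add: head4_def tail4_def glue_def vec_eq_iff forall_8 vector_4 vector_8)

lemma vec8_eq_iff: "x = y \<longleftrightarrow> head4 x = head4 y \<and> tail4 x = tail4 y"
  by (metis glue_head4_tail4)

lemma head4_linear_simps [simp]:
  fixes x y :: "'a::field^8"
  shows "head4 0 = (0::'a^4)" "head4 (x + y) = head4 x + head4 y"
    "head4 (x - y) = head4 x - head4 y" "head4 (k *s x) = k *s head4 x"
  by (simp_all add: head4_def vec_eq_iff forall_4 vector_4)

lemma tail4_linear_simps [simp]:
  fixes x y :: "'a::field^8"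
  shows "tail4 0 = (0::'a^4)" "tail4 (x + y) = tail4 x + tail4 y"
    "tail4 (x - y) = tail4 x - tail4 y" "tail4 (k *s x) = k *s tail4 x"
  by (simp_all add: tail4_def vec_eq_iff forall_4 vector_4)

section \<open>Equations of \<Sigma> and \<Sigma>'\<close>

lemma solid_Sigma_eq: "solid_Sigma = {x :: 'a::field^8. head4 x = 0}"
proof
  have "vec.subspace {x :: 'a^8. head4 x = 0}"
    by (simp add: vec.subspace_def)
  then show "solid_Sigma \<subseteq> {x :: 'a^8. head4 x = 0}"
    unfolding solid_Sigma_def
    by (intro vec.span_minimal) (simp_all add: head4_def vec_eq_iff forall_4 vector_4 axis_def)
  show "{x :: 'a^8. head4 x = 0} \<subseteq> solid_Sigma"
  proof
    fix x :: "'a^8" assume "x \<in> {x. head4 x = 0}"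
    then have "x = x $ 5 *s axis 5 1 + x $ 6 *s axis 6 1 + x $ 7 *s axis 7 1 + x $ 8 *s axis 8 1"
      by (simp add: head4_def vec_eq_iff forall_4 forall_8 vector_4 axis_def)
    also have "\<dots> \<in> solid_Sigma"
      unfolding solid_Sigma_def
      by (intro vec.span_add vec.span_scale vec.span_base) simp_all
    finally show "x \<in> solid_Sigma" .
  qed
qed

lemma solid_Sigma'_eq: "solid_Sigma' = {x :: 'a::field^8. tail4 x = 0}"
proof
  have "vec.subspace {x :: 'a^8. tail4 x = 0}"
    by (simp add: vec.subspace_def)
  then show "solid_Sigma' \<subseteq> {x :: 'a^8. tail4 x = 0}"
    unfolding solid_Sigma'_def
    by (intro vec.span_minimal) (simp_all add: tail4_def vec_eq_iff forall_4 vector_4 axis_def)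
  show "{x :: 'a^8. tail4 x = 0} \<subseteq> solid_Sigma'"
  proof
    fix x :: "'a^8" assume "x \<in> {x. tail4 x = 0}"
    then have "x = x $ 1 *s axis 1 1 + x $ 2 *s axis 2 1 + x $ 3 *s axis 3 1 + x $ 4 *s axis 4 1"
      by (simp add: tail4_def vec_eq_iff forall_4 forall_8 vector_4 axis_def)
    also have "\<dots> \<in> solid_Sigma'"
      unfolding solid_Sigma'_def
      by (intro vec.span_add vec.span_scale vec.span_base) simp_all
    finally show "x \<in> solid_Sigma'" .
  qed
qed

lemma subspace_solid_Sigma [simp]: "vec.subspace solid_Sigma"
  by (simp add: solid_Sigma_def)

lemma Sigma_Int_Sigma': "solid_Sigma \<inter> solid_Sigma' = {0 :: 'a::field^8}"
  by (auto simp: solid_Sigma_eq solid_Sigma'_eq vec8_eq_iff)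

lemma dim_solid_Sigma: "vec.dim (solid_Sigma :: ('a::{field,finite}^8) set) = 4"
proof (rule dim_eqI_card)
  have "solid_Sigma = range (glue (0 :: 'a^4))"
  proof
    show "solid_Sigma \<subseteq> range (glue (0 :: 'a^4))"
    proof
      fix x :: "'a^8" assume "x \<in> solid_Sigma"
      then have "x = glue 0 (tail4 x)" by (simp add: vec8_eq_iff solid_Sigma_eq)
      then show "x \<in> range (glue 0)" by (rule range_eqI)
    qed
  qed (auto simp: solid_Sigma_eq)
  moreover have "card (range (glue (0 :: 'a^4))) = CARD('a^4)"
    by (rule card_image) (rule inj_on_inverseI[of _ tail4], simp)
  ultimately show "card (solid_Sigma :: ('a^8) set) = CARD('a) ^ 4"
    by (simp only: CARD_vec) simp
qed simp

section \<open>Lifted matrices\<close>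

lemma vector_mult_id_block: "c v* id_block A = glue c (c v* A)"
  for A :: "'a::field^4^4"
  by (simp add: vec_eq_iff forall_8 glue_def id_block_def vector_8 vector_matrix_mult_def sum_4 mat_def)

lemma lifted_solid_range: "lifted_solid A = range (\<lambda>c. glue c (c v* A))"
  unfolding lifted_solid_def span_rows vector_mult_id_block ..

text \<open>L(A) is the graph of the linear map \<open>\<lambda>v. v v* A\<close> from heads to
  tails.\<close>

lemma mem_lifted_solid: "x \<in> lifted_solid A \<longleftrightarrow> tail4 x = head4 x v* A"
proof
  assume "tail4 x = head4 x v* A"
  then have "x = glue (head4 x) (head4 x v* A)"
    by (metis glue_head4_tail4)
  then show "x \<in> lifted_solid A"
    unfolding lifted_solid_range by (rule range_eqI)
qed (auto simp: lifted_solid_range)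

lemma subspace_lifted_solid [simp]: "vec.subspace (lifted_solid A)"
  by (simp add: lifted_solid_def)

lemma dim_lifted_solid: "vec.dim (lifted_solid A) = 4"
  for A :: "'a::{field,finite}^4^4"
proof (rule dim_eqI_card)
  have "inj (\<lambda>c. glue c (c v* A))"
    by (rule inj_on_inverseI[of _ head4]) simp
  then have "card (lifted_solid A) = CARD('a^4)"
    unfolding lifted_solid_range by (rule card_image)
  then show "card (lifted_solid A) = CARD('a) ^ 4"
    by (simp only: CARD_vec) simp
qed simp

text \<open>A graph determines its map, and the values at the unit vectors are the rows of the
  matrix.\<close>

lemma inj_lifted_solid: "inj (lifted_solid :: 'a::field^4^4 \<Rightarrow> _)"
proof (rule injI)
  fix A B :: "'a^4^4" assume eq: "lifted_solid A = lifted_solid B"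
  have "c v* A = c v* B" for c
  proof -
    have "glue c (c v* A) \<in> lifted_solid B"
      unfolding eq[symmetric] by (simp add: mem_lifted_solid)
    then show ?thesis by (simp add: mem_lifted_solid)
  qed
  then have "row i A = row i B" for i
    by (metis axis_vector_matrix_mult)
  then show "A = B"
    by (simp add: row_def vec_eq_iff)
qed

text \<open>On a graph, a zero head forces a zero tail. This later separates the lifted solids from
  those meeting \<Sigma> in a plane.\<close>

lemma lifted_solid_Int_Sigma: "lifted_solid A \<inter> solid_Sigma = {0}"
proof (intro equalityI subsetI)
  fix x assume "x \<in> lifted_solid A \<inter> solid_Sigma"
  then have h: "head4 x = 0" and t: "tail4 x = head4 x v* A"
    by (simp_all add: mem_lifted_solid solid_Sigma_eq)
  have "tail4 x = 0"
    unfolding t h by (simp add: vector_matrix_mult_def vec_eq_iff)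
  with h have "x = 0"
    by (simp add: vec8_eq_iff[of x 0])
  then show "x \<in> {0}"
    by simp
qed (simp add: vec.subspace_0)

text \<open>Two codewords with equal values at two independent vectors differ by a matrix of rank at
  most 2, so \<open>A \<mapsto> (u1 A, u2 A)\<close> is injective on the code; as the code has \<open>q^8\<close> elements, it is
  also surjective.\<close>
lemma mrd_code_interpolation:
  fixes \<A> :: "('a::{field,finite}^4^4) set"
  assumes mrd: "mrd_code_4_3 \<A>" and u: "u1 \<noteq> 0" "u2 \<notin> vec.span {u1}"
  obtains A where "A \<in> \<A>" "u1 v* A = v1" "u2 v* A = v2"
proof -
  define f where "f A = (u1 v* A, u2 v* A)" for A :: "'a^4^4"
  have diff: "u v* (A - B) = u v* A - u v* B" for u and A B :: "'a^4^4"
    by (simp add: vec_eq_iff vector_matrix_mult_def algebra_simps sum_subtractf)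
  have "inj_on f \<A>"
  proof (rule inj_onI, rule ccontr)
    fix A B assume AB: "A \<in> \<A>" "B \<in> \<A>" "f A = f B" "A \<noteq> B"
    have "rank (A - B) + 2 \<le> CARD(4)"
      using AB(3) by (intro rank_le_of_left_kernel[OF u]) (simp_all add: f_def diff)
    moreover have "rank (A - B) \<ge> 3"
      using AB mrd by (simp add: mrd_code_4_3_def)
    ultimately show False by simp
  qed
  then have "card (f ` \<A>) = CARD('a) ^ 8"
    using mrd by (simp add: card_image mrd_code_4_3_def)
  also have "\<dots> = CARD(('a^4) \<times> ('a^4))"
    by (simp add: card_prod flip: power_add)
  finally have "f ` \<A> = UNIV"
    by (intro card_subset_eq) auto
  then obtain A where "A \<in> \<A>" "f A = (v1, v2)"
    by (metis UNIV_I imageE)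
  then show ?thesis
    using that by (auto simp: f_def)
qed

text \<open>Since \<open>R\<close> meets \<Sigma> trivially, \<open>head4\<close> is injective on
  \<open>R\<close>. Hence the heads of two generators are independent, and a codeword can be made to
  send them to the corresponding tails.\<close>

lemma lifted_solid_covers:
  fixes \<A> :: "('a::{field,finite}^4^4) set"
  assumes mrd: "mrd_code_4_3 \<A>" and R: "vec.subspace R" "vec.dim R = 2"
    and disj: "R \<inter> solid_Sigma \<subseteq> {0}"
  shows "\<exists>A\<in>\<A>. R \<subseteq> lifted_solid A"
proof -
  have "\<not> R \<subseteq> {0}"
    using R by (auto simp flip: vec.dim_eq_0)
  then obtain r where r: "r \<in> R" "r \<noteq> 0" by auto
  obtain w where w: "w \<in> R" "w \<notin> vec.span {r}" "R = vec.span {w, r}"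
    using dim_2_eq_span_pair[OF R r] by blast
  have "head4 r \<noteq> 0"
    using r disj by (auto simp: solid_Sigma_eq)
  \<comment> \<open>A dependency between the heads would produce the vector
    \<open>w - k *s r\<close> of \<open>R\<close> with zero head.\<close>
  moreover have "head4 w \<notin> vec.span {head4 r}"
  proof
    assume "head4 w \<in> vec.span {head4 r}"
    then obtain k where "head4 w = k *s head4 r"
      by (auto simp: vec.span_singleton)
    then have "w - k *s r \<in> solid_Sigma"
      by (simp add: solid_Sigma_eq)
    moreover have "w - k *s r \<in> R"
      using w(1) r(1) R(1) by (simp add: vec.subspace_diff vec.subspace_scale)
    ultimately have "w = k *s r"
      using disj by auto
    then show False
      using w(2) by (auto simp: vec.span_singleton)
  qed
  ultimately obtain A where A: "A \<in> \<A>" "head4 r v* A = tail4 r" "head4 w v* A = tail4 w"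
    using mrd_code_interpolation[OF mrd] by metis
  have "R \<subseteq> lifted_solid A"
    unfolding w(3) by (rule vec.span_minimal) (simp_all add: mem_lifted_solid A)
  with A(1) show ?thesis by blast
qed
section \<open>Spreads\<close>

lemma mem_proj_subspaces: "W \<in> proj_subspaces d \<longleftrightarrow> vec.subspace W \<and> int (vec.dim W) = d + 1"
  by (auto simp: proj_subspaces_def proj_dim_def)

lemma line_spread_lines:
  assumes "line_spread T S" "l \<in> S"
  shows "vec.subspace l" "vec.dim l = 2" "l \<subseteq> T"
  using assms by (auto simp: line_spread_def mem_proj_subspaces)

lemma span_singleton_point: "p \<noteq> 0 \<Longrightarrow> vec.span {p} \<in> pg_points"
  by (simp add: mem_proj_subspaces)

lemma line_spread_point:
  assumes "line_spread T S" "p \<noteq> 0" "vec.span {p} \<subseteq> T"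
  shows "\<exists>!l. l \<in> S \<and> vec.span {p} \<subseteq> l"
  using assms span_singleton_point[OF assms(2)] by (simp add: line_spread_def)

text \<open>Passes from points as subspaces to nonzero vectors.\<close>

lemma line_spread_ex:
  assumes S: "line_spread T S" and T: "vec.subspace T" and p: "p \<in> T" "p \<noteq> 0"
  obtains l where "l \<in> S" "p \<in> l"
proof -
  have "vec.span {p} \<subseteq> T"
    using p T by (intro vec.span_minimal) auto
  then obtain l where "l \<in> S" "vec.span {p} \<subseteq> l"
    using line_spread_point[OF S p(2)] by blast
  moreover have "p \<in> vec.span {p}"
    by (rule vec.span_base) simp
  ultimately show ?thesis
    using that by blast
qed

text \<open>A common nonzero vector would span a point lying on two lines of the spread.\<close>

lemma line_spread_disjoint:
  assumes S: "line_spread T S" and l: "l1 \<in> S" "l2 \<in> S" "l1 \<noteq> l2"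
  shows "l1 \<inter> l2 \<subseteq> {0}"
proof
  fix p assume p: "p \<in> l1 \<inter> l2"
  show "p \<in> {0}"
  proof (rule ccontr)
    assume "p \<notin> {0}"
    then have p0: "p \<noteq> 0"
      by simp
    have sub: "vec.span {p} \<subseteq> l1" "vec.span {p} \<subseteq> l2"
      by (rule vec.span_minimal, use p in simp, rule line_spread_lines(1)[OF S], rule l)+
    moreover have "vec.span {p} \<subseteq> T"
      using sub(1) line_spread_lines(3)[OF S l(1)] by (rule subset_trans)
    ultimately show False
      using line_spread_point[OF S p0] l by blast
  qed
qed

section \<open>The solids meeting \<open>\<Sigma>\<close> in a plane\<close>

lemma Sigma_Int_line:
  fixes l' :: "('a::field^8) set"
  assumes "l' \<subseteq> solid_Sigma'"
  shows "solid_Sigma \<inter> l' \<subseteq> {0}"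
  using Sigma_Int_Sigma' assms by blast

text \<open>\<Sigma> and \<open>l'\<close> are skew, so dimensions add; a line gives vector
  dimension 6, that is, projective dimension 5.\<close>

lemma dim_Gamma_sub:
  fixes l' :: "('a::{field,finite}^8) set"
  assumes "vec.subspace l'" "l' \<subseteq> solid_Sigma'"
  shows "vec.dim (Gamma_sub l') = 4 + vec.dim l'"
  unfolding Gamma_sub_def pg_join_def
  using dim_span_Un_disjoint[OF subspace_solid_Sigma assms(1) Sigma_Int_line[OF assms(2)]]
  by (simp only: dim_solid_Sigma)

lemma subspace_Gamma_sub [simp]: "vec.subspace (Gamma_sub l')"
  by (simp add: Gamma_sub_def pg_join_def)

lemma Sigma_subset_Gamma_sub: "solid_Sigma \<subseteq> Gamma_sub l'"
  unfolding Gamma_sub_def pg_join_def by (auto intro: vec.span_base)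

text \<open>Compare two decompositions \<open>s + y = t + z\<close> of a common vector:
  \<open>y\<close> and \<open>z\<close> have equal heads and zero tails, so they agree and lie in
  both lines. Only the summand in \<Sigma> remains.\<close>

lemma Gamma_sub_Int:
  fixes l1 l2 :: "('a::field^8) set"
  assumes l1: "vec.subspace l1" "l1 \<subseteq> solid_Sigma'" and l2: "vec.subspace l2" "l2 \<subseteq> solid_Sigma'"
    and disj: "l1 \<inter> l2 \<subseteq> {0}"
  shows "Gamma_sub l1 \<inter> Gamma_sub l2 \<subseteq> solid_Sigma"
proof
  have split: "\<exists>s y. s \<in> solid_Sigma \<and> y \<in> l \<and> x = s + y"
    if "vec.subspace l" "x \<in> Gamma_sub l" for x and l :: "('a^8) set"
  proof -
    have eq: "vec.span l = l" "vec.span solid_Sigma = (solid_Sigma :: ('a^8) set)"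
      using that(1) subspace_solid_Sigma vec.span_eq_iff by blast+
    show ?thesis
      using that(2) unfolding Gamma_sub_def pg_join_def vec.span_Un eq by blast
  qed
  fix x assume "x \<in> Gamma_sub l1 \<inter> Gamma_sub l2"
  then obtain s y t z where x: "s \<in> solid_Sigma" "y \<in> l1" "x = s + y"
      "t \<in> solid_Sigma" "z \<in> l2" "x = t + z"
    using split[OF l1(1)] split[OF l2(1)] by blast
  have "head4 x = head4 y"
    using x(1) unfolding x(3) by (simp add: solid_Sigma_eq)
  moreover have "head4 x = head4 z"
    using x(4) unfolding x(6) by (simp add: solid_Sigma_eq)
  ultimately have h: "head4 y = head4 z"
    by simp
  have "tail4 y = 0" "tail4 z = 0"
    using x l1(2) l2(2) by (auto simp: solid_Sigma'_eq)
  with h have "y = z"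
    by (simp add: vec8_eq_iff[of y z])
  then have "y = 0"
    using x disj by blast
  then show "x \<in> solid_Sigma"
    using x by simp
qed

text \<open>Translates to vector dimensions, one more than the projective ones.\<close>

lemma mem_Y_solids:
  "W \<in> Y_solids \<mu> l' \<longleftrightarrow> vec.subspace W \<and> vec.dim W = 4 \<and> W \<subseteq> Gamma_sub l'
    \<and> vec.dim (W \<inter> solid_Sigma) = 3 \<and> \<mu> l' \<subseteq> W \<inter> solid_Sigma"
proof -
  have sub: "vec.subspace W \<Longrightarrow> vec.subspace (W \<inter> solid_Sigma)"
    by (rule vec.subspace_inter) simp_all
  show ?thesis
    using sub by (auto simp: Y_solids_def mem_proj_subspaces)
qed

text \<open>Choose the plane \<open>E\<close> of \<Sigma> through \<open>\<mu> l'\<close> in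
  \<open>q + 1\<close> ways, then a solid of \<Gamma> meeting \<Sigma> exactly in \<open>E\<close>
  in \<open>q * (q + 1)\<close> ways. Both numbers come from \<open>card_extensions\<close>.\<close>

lemma card_Y_solids:
  fixes \<mu> :: "('a::{field,finite}^8) set \<Rightarrow> ('a^8) set"
  assumes l': "vec.subspace l'" "vec.dim l' = 2" "l' \<subseteq> solid_Sigma'"
    and m: "vec.subspace (\<mu> l')" "vec.dim (\<mu> l') = 2" "\<mu> l' \<subseteq> solid_Sigma"
  shows "card (Y_solids \<mu> l') = CARD('a) * (CARD('a) + 1)^2"
proof -
  let ?q = "CARD('a)"
  have q: "2 \<le> ?q" by (rule card_field_ge_2)
  \<comment> \<open>The condition \<open>E \<inter> \<mu> l' = \<mu> l'\<close> puts
    \<open>P\<close> into the form of \<open>card_extensions\<close> with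
    \<open>T = B\<close>.\<close>
  define P where "P = {E. vec.subspace E \<and> E \<subseteq> solid_Sigma \<and> vec.dim E = vec.dim (\<mu> l') + 1 \<and> E \<inter> \<mu> l' = \<mu> l'}"
  define F where "F E = {W. vec.subspace W \<and> W \<subseteq> Gamma_sub l' \<and> vec.dim W = vec.dim E + 1 \<and> W \<inter> solid_Sigma = E}" for E
  have pos: "0 < ?q ^ (n + 1) - ?q ^ n" for n
    using q by simp
  \<comment> \<open>Exhibits the positive factor to be cancelled, so both counts avoid
    division.\<close>
  have two_steps: "?q ^ (n + 2) - ?q ^ n = (?q + 1) * (?q ^ (n + 1) - ?q ^ n)" for n
  proof -
    have "(?q + 1) * (?q ^ (n + 1) - ?q ^ n) = (?q ^ (n + 2) + ?q ^ (n + 1)) - (?q ^ n + ?q ^ (n + 1))"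
      unfolding diff_mult_distrib2 by (simp add: algebra_simps)
    then show ?thesis by simp
  qed
  have "card P * (?q ^ (2 + 1) - ?q ^ 2) = ?q ^ (2 + 2) - ?q ^ 2"
    using card_extensions[OF m(1) m(1) subspace_solid_Sigma order_refl m(3)]
    by (simp only: P_def dim_solid_Sigma m(2)) simp
  also have "\<dots> = (?q + 1) * (?q ^ (2 + 1) - ?q ^ 2)"
    by (rule two_steps)
  finally have cP: "card P = ?q + 1"
    using pos[of 2] mult_right_cancel by blast
  have cF: "card (F E) = ?q * (?q + 1)" if "E \<in> P" for E
  proof -
    have E: "vec.subspace E" "E \<subseteq> solid_Sigma" "vec.dim E = 3"
      using that m(2) by (auto simp: P_def)
    \<comment> \<open>The exponents are the dimensions: 3 for \<open>E\<close>, 4 for \<Sigma> and 6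
      for \<Gamma>.\<close>
    have "card (F E) * (?q ^ (3 + 1) - ?q ^ 3) = ?q ^ (4 + 2) - ?q ^ 4"
      using card_extensions[OF E(1) subspace_solid_Sigma subspace_Gamma_sub E(2) Sigma_subset_Gamma_sub, of l']
      by (simp only: F_def dim_solid_Sigma E(3) dim_Gamma_sub[OF l'(1,3)] l'(2))
    also have "\<dots> = (?q + 1) * (?q ^ (4 + 1) - ?q ^ 4)"
      by (rule two_steps)
    also have "?q ^ (4 + 1) - ?q ^ 4 = ?q * (?q ^ (3 + 1) - ?q ^ 3)"
      by (simp add: diff_mult_distrib2 numeral_eq_Suc)
    finally have "card (F E) * (?q ^ (3 + 1) - ?q ^ 3) = (?q * (?q + 1)) * (?q ^ (3 + 1) - ?q ^ 3)"
      by (simp only: mult_ac)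
    then show ?thesis
      using pos[of 3] mult_right_cancel by blast
  qed
  have "Y_solids \<mu> l' = (\<Union>E\<in>P. F E)"
  proof (intro set_eqI iffI)
    fix W assume "W \<in> Y_solids \<mu> l'"
    then have W: "vec.subspace W" "vec.dim W = 4" "W \<subseteq> Gamma_sub l'"
      "vec.dim (W \<inter> solid_Sigma) = 3" "\<mu> l' \<subseteq> W \<inter> solid_Sigma"
      by (simp_all add: mem_Y_solids)
    have "W \<inter> solid_Sigma \<in> P"
      using W m vec.subspace_inter[OF W(1) subspace_solid_Sigma] by (auto simp: P_def)
    moreover have "W \<in> F (W \<inter> solid_Sigma)"
      using W by (auto simp: F_def)
    ultimately show "W \<in> (\<Union>E\<in>P. F E)" by blast
  next
    fix W assume "W \<in> (\<Union>E\<in>P. F E)"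
    then show "W \<in> Y_solids \<mu> l'"
      using m(2) by (auto simp: P_def F_def mem_Y_solids)
  qed
  \<comment> \<open>The families are disjoint because a solid \<open>W\<close> determines its plane
    as \<open>W \<inter> solid_Sigma\<close>.\<close>
  moreover have "card (\<Union>E\<in>P. F E) = (\<Sum>E\<in>P. card (F E))"
    by (rule card_UN_disjoint) (auto simp: F_def)
  ultimately show ?thesis
    by (simp add: cF cP power2_eq_square algebra_simps)
qed

section \<open>Covering the lines that meet \<Sigma>\<close>

lemma Y_solids_cover:
  fixes S S' :: "('a::{field,finite}^8) set set" and \<mu> :: "('a^8) set \<Rightarrow> ('a^8) set"
  assumes S: "line_spread solid_Sigma S" and S': "line_spread solid_Sigma' S'" and \<mu>: "bij_betw \<mu> S' S"
    and R: "vec.subspace R" "vec.dim R = 2" and meet: "\<not> R \<inter> solid_Sigma \<subseteq> {0}"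
  shows "\<exists>l'\<in>S'. \<exists>W\<in>Y_solids \<mu> l'. R \<subseteq> W"
proof -
  obtain p where p: "p \<in> R" "p \<in> solid_Sigma" "p \<noteq> 0"
    using meet by auto
  obtain w where w: "R = vec.span {w, p}"
    using dim_2_eq_span_pair[OF R p(1,3)] by metis
  have \<mu>S: "vec.subspace (\<mu> l')" "vec.dim (\<mu> l') = 2" "\<mu> l' \<subset> solid_Sigma" if "l' \<in> S'" for l'
  proof -
    have "\<mu> l' \<in> S" using \<mu> that by (auto simp: bij_betw_def)
    note l = line_spread_lines[OF S this]
    show "vec.subspace (\<mu> l')" "vec.dim (\<mu> l') = 2" using l by blast+
    have "\<mu> l' \<noteq> solid_Sigma" using l(2) dim_solid_Sigma[where 'a='a] by auto
    then show "\<mu> l' \<subset> solid_Sigma" using l(3) by blast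
  qed
  \<comment> \<open>Common to both cases: joining a plane \<open>E\<close> of \<Sigma> through
    \<open>\<mu> l'\<close> and \<open>p\<close> to a vector \<open>v\<close> of \<Gamma> off
    \<Sigma> gives a solid of the family, which contains \<open>R\<close> once it contains
    \<open>w\<close>.\<close>
  have ext: "\<exists>W\<in>Y_solids \<mu> l'. R \<subseteq> W"
    if l': "l' \<in> S'" and E: "vec.subspace E" "E \<subseteq> solid_Sigma" "\<mu> l' \<subseteq> E" "vec.dim E = 3" "p \<in> E"
      and v: "v \<in> Gamma_sub l'" "v \<notin> solid_Sigma" "w \<in> vec.span (insert v E)" for l' E v
  proof
    let ?W = "vec.span (insert v E)"
    have "insert v E \<subseteq> Gamma_sub l'"
      using v(1) E(2) Sigma_subset_Gamma_sub[of l'] by blast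
    then have "?W \<subseteq> Gamma_sub l'"
      by (rule vec.span_minimal) simp
    moreover have "vec.dim ?W = 4"
      using dim_span_insert_subspace[OF E(1), of v] v(2) E(2,4) by auto
    moreover have "?W \<inter> solid_Sigma = E"
      using span_insert_Int_subspace[OF E(1) subspace_solid_Sigma E(2) v(2)] .
    ultimately show "?W \<in> Y_solids \<mu> l'"
      using E(3,4) by (simp add: mem_Y_solids)
    show "R \<subseteq> ?W"
      unfolding w using v(3) E(5) by (intro vec.span_minimal) (auto intro: vec.span_base)
  qed
  show ?thesis
  proof (cases "w \<in> solid_Sigma")
    case True
    \<comment> \<open>Here \<open>R\<close> lies in \<Sigma>. Surjectivity of \<mu> makes the spread
      line through \<open>p\<close> equal to some \<open>\<mu> l'\<close>, so a plane through it and
      \<open>w\<close> contains \<open>R\<close>.\<close>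
    obtain l where l: "l \<in> S" "p \<in> l"
      using line_spread_ex[OF S subspace_solid_Sigma p(2,3)] by blast
    then obtain l' where l': "l' \<in> S'" "l = \<mu> l'"
      using \<mu> by (auto simp: bij_betw_def)
    obtain E where E: "vec.subspace E" "E \<subseteq> solid_Sigma" "\<mu> l' \<subseteq> E" "w \<in> E" "vec.dim E = vec.dim (\<mu> l') + 1"
      using exists_extension_containing[OF \<mu>S(1)[OF l'(1)] subspace_solid_Sigma \<mu>S(3)[OF l'(1)] True] by blast
    \<comment> \<open>The solid still needs a vector off \<Sigma>; any nonzero vector of
      \<open>l'\<close> will do.\<close>
    have "\<not> l' \<subseteq> {0}"
      using line_spread_lines(2)[OF S' l'(1)] by (auto simp flip: vec.dim_eq_0)
    then obtain v where v: "v \<in> l'" "v \<noteq> 0" by blast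
    then have "v \<notin> solid_Sigma"
      using Sigma_Int_line[OF line_spread_lines(3)[OF S' l'(1)]] by blast
    moreover have "v \<in> Gamma_sub l'"
      unfolding Gamma_sub_def pg_join_def using v(1) by (auto intro: vec.span_base)
    moreover have "w \<in> vec.span (insert v E)"
      using E(4) by (auto intro: vec.span_base)
    ultimately have "\<exists>W\<in>Y_solids \<mu> l'. R \<subseteq> W"
      using E \<mu>S(2)[OF l'(1)] l l' by (intro ext[of l' E v]) auto
    then show ?thesis using l'(1) by blast
  next
    case False
    \<comment> \<open>The projection of \<open>w\<close> from \<Sigma> onto \<Sigma>'. As
      \<open>w - u\<close> lies in \<Sigma>, the spread line through \<open>u\<close> has
      \<open>w\<close> in its \<Gamma>, and \<open>w\<close> itself can play the role of
      \<open>v\<close>.\<close>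
    define u where "u = glue (head4 w) 0"
    have "u \<in> solid_Sigma'" "u \<noteq> 0"
      using False by (auto simp: u_def solid_Sigma'_eq solid_Sigma_eq vec8_eq_iff[of _ 0])
    moreover have "vec.subspace (solid_Sigma' :: ('a^8) set)"
      by (simp add: solid_Sigma'_def)
    ultimately obtain l' where l': "l' \<in> S'" "u \<in> l'"
      using line_spread_ex[OF S'] by blast
    have "u + (w - u) \<in> Gamma_sub l'"
    proof (rule vec.subspace_add)
      show "u \<in> Gamma_sub l'"
        unfolding Gamma_sub_def pg_join_def using l'(2) by (auto intro: vec.span_base)
      have "w - u \<in> solid_Sigma"
        by (simp add: u_def solid_Sigma_eq)
      then show "w - u \<in> Gamma_sub l'"
        using Sigma_subset_Gamma_sub by blast
    qed simp
    then have "w \<in> Gamma_sub l'" by simp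
    moreover obtain E where E: "vec.subspace E" "E \<subseteq> solid_Sigma" "\<mu> l' \<subseteq> E" "p \<in> E" "vec.dim E = vec.dim (\<mu> l') + 1"
      using exists_extension_containing[OF \<mu>S(1)[OF l'(1)] subspace_solid_Sigma \<mu>S(3)[OF l'(1)] p(2)] by blast
    ultimately have "\<exists>W\<in>Y_solids \<mu> l'. R \<subseteq> W"
      using \<mu>S(2)[OF l'(1)] l' False
      by (intro ext[of l' E w]) (auto intro: vec.span_base)
    then show ?thesis using l'(1) by blast
  qed
qed

section \<open>Assembling the design and its size\<close>

theorem theorem4p2:
  fixes q :: nat
    and \<A> :: "('a::{field,finite}^4^4) set"
    and S S' :: "('a^8) set set"
    and \<mu> :: "('a^8) set \<Rightarrow> ('a^8) set"
    and \<X> \<Y> :: "('a^8) set set"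
  assumes "q = CARD('a)"
    and "mrd_code_4_3 \<A>"
    and "\<X> = lifted_solid ` \<A>"
    and "line_spread solid_Sigma S"
    and "line_spread solid_Sigma' S'"
    and "bij_betw \<mu> S' S"
    and "\<Y> = (\<Union>l'\<in>S'. Y_solids \<mu> l')"
  shows "\<X> \<subseteq> pg_solids \<and> card \<X> = q^8
    \<and> (\<forall>l'\<in>S'. Gamma_sub l' \<in> proj_subspaces 5 \<and> card (Y_solids \<mu> l') = q * (q + 1)^2)
    \<and> q_covering_design 4 2 (\<X> \<union> \<Y>)
    \<and> card (\<X> \<union> \<Y>) = q^8 + q * (q + 1)^2 * (q^2 + 1)"
proof -
  note q = assms(1) and mrd = assms(2) and X = assms(3) and S = assms(4) and S' = assms(5)
    and \<mu> = assms(6) and Y = assms(7)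
  have Xsolids: "\<X> \<subseteq> pg_solids"
    by (auto simp: X mem_proj_subspaces dim_lifted_solid)
  have Ysolids: "\<Y> \<subseteq> pg_solids"
    by (auto simp: Y mem_Y_solids mem_proj_subspaces)
  have cX: "card \<X> = q ^ 8"
    using mrd card_image[OF inj_on_subset[OF inj_lifted_solid subset_UNIV], of \<A>]
    by (simp add: X q mrd_code_4_3_def)
  have Gam: "Gamma_sub l' \<in> proj_subspaces 5" if "l' \<in> S'" for l'
    using line_spread_lines[OF S' that] by (simp add: mem_proj_subspaces dim_Gamma_sub)
  have cYl: "card (Y_solids \<mu> l') = q * (q + 1)^2" if "l' \<in> S'" for l'
  proof -
    have "\<mu> l' \<in> S"
      using \<mu> that by (auto simp: bij_betw_def)
    then show ?thesis
      unfolding q by (intro card_Y_solids line_spread_lines[OF S' that] line_spread_lines[OF S])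
  qed
  \<comment> \<open>A solid in two families would lie in the intersection of two \<Gamma>'s, hence
    inside \<Sigma>, and could not meet \<Sigma> in just a plane.\<close>
  have Y_disj: "Y_solids \<mu> l1 \<inter> Y_solids \<mu> l2 = {}" if "l1 \<in> S'" "l2 \<in> S'" "l1 \<noteq> l2" for l1 l2
  proof (rule ccontr)
    assume "Y_solids \<mu> l1 \<inter> Y_solids \<mu> l2 \<noteq> {}"
    then obtain W where "W \<in> Y_solids \<mu> l1" "W \<in> Y_solids \<mu> l2"
      by blast
    then have W: "vec.dim W = 4" "vec.dim (W \<inter> solid_Sigma) = 3" "W \<subseteq> Gamma_sub l1 \<inter> Gamma_sub l2"
      by (simp_all add: mem_Y_solids)
    have "Gamma_sub l1 \<inter> Gamma_sub l2 \<subseteq> solid_Sigma"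
      using line_spread_lines[OF S' that(1)] line_spread_lines[OF S' that(2)] line_spread_disjoint[OF S' that]
      by (intro Gamma_sub_Int)
    then have "W \<inter> solid_Sigma = W"
      using W(3) by blast
    then show False
      using W(1,2) by simp
  qed
  have "card \<Y> = (\<Sum>l'\<in>S'. card (Y_solids \<mu> l'))"
    unfolding Y by (rule card_UN_disjoint) (use Y_disj in auto)
  also have "\<dots> = q * (q + 1)^2 * (q^2 + 1)"
    using cYl S' by (simp add: line_spread_def q)
  finally have cY: "card \<Y> = q * (q + 1)^2 * (q^2 + 1)" .
  \<comment> \<open>The intersection with \<Sigma> has vector dimension 0 for solids of the first
    kind and 3 for those of the second.\<close>
  have "\<X> \<inter> \<Y> = {}"
  proof (rule ccontr)
    assume "\<X> \<inter> \<Y> \<noteq> {}"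
    then obtain A l' where "lifted_solid A \<in> Y_solids \<mu> l'"
      unfolding X Y by blast
    then show False
      by (simp add: mem_Y_solids lifted_solid_Int_Sigma)
  qed
  then have card: "card (\<X> \<union> \<Y>) = q^8 + q * (q + 1)^2 * (q^2 + 1)"
    by (simp add: card_Un_disjoint cX cY)
  have cover: "\<exists>W\<in>\<X> \<union> \<Y>. R \<subseteq> W" if "vec.subspace R" "vec.dim R = 2" for R
  proof (cases "R \<inter> solid_Sigma \<subseteq> {0}")
    case True
    then show ?thesis
      using lifted_solid_covers[OF mrd that] by (auto simp: X)
  next
    case False
    then show ?thesis
      using Y_solids_cover[OF S S' \<mu> that] by (auto simp: Y)
  qed
  have "q_covering_design 4 2 (\<X> \<union> \<Y>)"
    unfolding q_covering_design_def
    using Xsolids Ysolids cover by (auto simp: mem_proj_subspaces)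
  then show ?thesis
    using Xsolids cX Gam cYl card by simp
qed

end
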